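(* There exists an absolute constant $c>0$ such that for every $n\geq 1$ and every log-concave probability measure $\mu$ on $\mathbb{R}^n$, $$\int_{\mathbb{R}^n}\varphi_{\mu}(x)\,d\mu(x)\geq e^{-cn}.$$
   Context: A log-concave probability measure on $\mathbb{R}^n$ is a Borel probability measure $\mu$ such that $\mu(\lambda A+(1-\lambda)B)\geq \mu(A)^{\lambda}\mu(B)^{1-\lambda}$ for all compact $A,B\subseteq\mathbb{R}^n$ and $\lambda\in(0,1)$, and $\mu(H)<1$ for every hyperplane $H$. Tukey's half-space depth is $\varphi_\mu(x)=\inf\{\mu(H): H$ a half-space of $\mathbb{R}^n$ containing $x\}$. *)

theory Defs
  imports "HOL-Probability.Probability"
begin

text \<open>R^n is represented inside nat \<Rightarrow> real (product topology) as the
  functions vanishing at all coordinates i \<ge> n.\<close>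
definition Rn :: "nat \<Rightarrow> (nat \<Rightarrow> real) set" where
  "Rn n = {x. \<forall>i\<ge>n. x i = 0}"

definition borel_Rn :: "nat \<Rightarrow> (nat \<Rightarrow> real) measure" where
  "borel_Rn n = restrict_space borel (Rn n)"

definition inner_n :: "nat \<Rightarrow> (nat \<Rightarrow> real) \<Rightarrow> (nat \<Rightarrow> real) \<Rightarrow> real" where
  "inner_n n u x = (\<Sum>i<n. u i * x i)"

definition halfspaces_Rn :: "nat \<Rightarrow> (nat \<Rightarrow> real) set set" where
  "halfspaces_Rn n = {{x \<in> Rn n. inner_n n u x \<le> a} | u a. u \<in> Rn n \<and> (\<exists>i<n. u i \<noteq> 0)}"

definition hyperplanes_Rn :: "nat \<Rightarrow> (nat \<Rightarrow> real) set set" where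
  "hyperplanes_Rn n = {{x \<in> Rn n. inner_n n u x = a} | u a. u \<in> Rn n \<and> (\<exists>i<n. u i \<noteq> 0)}"

definition minkowski_comb :: "real \<Rightarrow> (nat \<Rightarrow> real) set \<Rightarrow> (nat \<Rightarrow> real) set \<Rightarrow> (nat \<Rightarrow> real) set" where
  "minkowski_comb t A B = {(\<lambda>i. t * a i + (1 - t) * b i) | a b. a \<in> A \<and> b \<in> B}"

definition log_concave_prob :: "nat \<Rightarrow> (nat \<Rightarrow> real) measure \<Rightarrow> bool" where
  "log_concave_prob n \<mu> \<longleftrightarrow>
     prob_space \<mu> \<and> sets \<mu> = sets (borel_Rn n) \<and>
     (\<forall>(A::(nat \<Rightarrow> real) set) B (t::real). A \<subseteq> Rn n \<longrightarrow> B \<subseteq> Rn n \<longrightarrow> compact A \<longrightarrow> compact B \<longrightarrow> 0 < t \<longrightarrow> t < 1 \<longrightarrow>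
        measure \<mu> (minkowski_comb t A B) \<ge> measure \<mu> A powr t * measure \<mu> B powr (1 - t)) \<and>
     (\<forall>H \<in> hyperplanes_Rn n. measure \<mu> H < 1)"

definition tukey_depth :: "nat \<Rightarrow> (nat \<Rightarrow> real) measure \<Rightarrow> (nat \<Rightarrow> real) \<Rightarrow> real" where
  "tukey_depth n \<mu> x = (INF H \<in> {H \<in> halfspaces_Rn n. x \<in> H}. measure \<mu> H)"

end

theory Submission
  imports Defs
begin

text \<open>
  For a density \<open>f\<close>, a half-space containing \<open>x\<close> contains \<open>v\<close> or \<open>2x - v\<close> for every \<open>v\<close>, so the depth of
  \<open>x\<close> is at least \<open>1/2 \<integral> min (f v) (f (2x - v)) dv\<close>. Integrating against \<open>f\<close> and substituting
  \<open>w = 2x - v\<close> bounds the average depth below by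
  \<open>2^(-n-1) \<integral>\<integral> f ((v + w)/2) min (f v) (f w) dv dw\<close>. By log-concavity the set \<open>{f \<ge> e^(-cn) max f}\<close>
  carries at least half of the mass, and restricting \<open>v\<close> and \<open>w\<close> to it gives the exponential bound.

  No density is needed: \<open>f\<close> is replaced by the measure of cubes of side \<open>2r\<close> centred at the points
  of \<open>r \<int>^n\<close>, where midpoint log-concavity is inherited directly from the measure. Bounded overlap
  of the cubes costs only factors \<open>5^n\<close>, the half-spaces get enlarged by \<open>O(r)\<close>, and reverse Fatou
  removes the enlargement as \<open>r \<rightarrow> 0\<close>.
\<close>

section \<open>Cells, lattice points and bounded overlap\<close>

text \<open>Centres are in units of \<open>r / 2\<close>, so that \<open>v + w\<close> indexes the midpoint of the cubes at
  \<open>2 v\<close> and \<open>2 w\<close>.\<close>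

definition cell :: "nat \<Rightarrow> real \<Rightarrow> (nat \<Rightarrow> int) \<Rightarrow> (nat \<Rightarrow> real) set" where
  "cell n r m = {x \<in> Rn n. \<forall>i<n. \<bar>x i - r * of_int (m i) / 2\<bar> \<le> r}"

definition Zn :: "nat \<Rightarrow> (nat \<Rightarrow> int) set" where
  "Zn n = {k. \<forall>i\<ge>n. k i = 0}"

text \<open>Log-concavity is assumed for compact sets only. In the product topology a cell is a
  product of closed intervals and, from coordinate \<open>n\<close> on, of singletons
  \<open>{0}\<close>, so Tychonoff applies.\<close>

lemma compact_cell: "compact (cell n r m)"
proof -
  define S where "S i = (if i < n then {r * of_int (m i) / 2 - r .. r * of_int (m i) / 2 + r} else {0})" for i
  have "cell n r m = PiE UNIV S"
    by (auto simp: cell_def Rn_def S_def PiE_iff abs_le_iff algebra_simps split: if_splits)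
  moreover have "compactin (product_topology (\<lambda>i. euclidean) UNIV) (PiE UNIV S)"
    unfolding compactin_PiE by (auto simp: S_def)
  ultimately show ?thesis
    by (simp add: euclidean_product_topology)
qed

text \<open>A closed interval of length 4 contains at most 5 integers. Every factor
  \<open>5 ^ n\<close> of the proof originates here.\<close>

lemma card_lattice_le:
  fixes y :: "nat \<Rightarrow> real" and K :: "(nat \<Rightarrow> int) set"
  assumes "K \<subseteq> Zn n"
  shows "card {k \<in> K. \<forall>i<n. \<bar>of_int (k i) - y i\<bar> \<le> 2} \<le> 5 ^ n"
proof -
  let ?B = "\<lambda>i. {\<lceil>y i - 2\<rceil>..\<lfloor>y i + 2\<rfloor>}"
  have "card {k \<in> K. \<forall>i<n. \<bar>of_int (k i) - y i\<bar> \<le> 2} \<le> card (PiE_dflt {..<n} 0 ?B)"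
  proof (intro card_mono finite_PiE_dflt subsetI)
    fix k assume k: "k \<in> {k \<in> K. \<forall>i<n. \<bar>of_int (k i) - y i\<bar> \<le> 2}"
    have "k i \<in> ?B i" if "i < n" for i
    proof -
      have "\<bar>of_int (k i) - y i\<bar> \<le> 2"
        using k that by blast
      then show ?thesis
        by simp linarith
    qed
    then show "k \<in> PiE_dflt {..<n} 0 ?B"
      using k assms by (auto simp: PiE_dflt_def Zn_def)
  qed auto
  also have "\<dots> = (\<Prod>i<n. card (?B i))"
    by (intro card_PiE_dflt) auto
  also have "\<dots> \<le> (\<Prod>i<n. 5)"
    by (intro prod_mono) (auto; linarith)
  finally show ?thesis by simp
qed

text \<open>The sum of the indicators counts the sets that contain a point: at most \<open>m\<close>
  inside \<open>B\<close>, none outside. Integrate this bound.\<close>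

lemma (in finite_measure) sum_measure_le_overlap:
  assumes "finite K" "\<And>k. k \<in> K \<Longrightarrow> A k \<in> sets M" "\<And>k. k \<in> K \<Longrightarrow> A k \<subseteq> B" "B \<in> sets M"
    and "\<And>x. x \<in> B \<Longrightarrow> card {k \<in> K. x \<in> A k} \<le> m"
  shows "(\<Sum>k\<in>K. measure M (A k)) \<le> real m * measure M B"
proof -
  have "(\<Sum>k\<in>K. measure M (A k)) = (\<Sum>k\<in>K. \<integral>x. indicator (A k) x \<partial>M)"
    using assms(2) sets.Int_space_eq2 by (intro sum.cong) auto
  also have "\<dots> = (\<integral>x. (\<Sum>k\<in>K. indicator (A k) x) \<partial>M)"
    using assms(2) by (intro Bochner_Integration.integral_sum[symmetric]) (auto simp: emeasure_eq_measure)
  also have "\<dots> \<le> (\<integral>x. real m * indicator B x \<partial>M)"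
  proof (intro integral_mono)
    show "integrable M (\<lambda>x. \<Sum>k\<in>K. indicator (A k) x :: real)"
      using assms(2) by (intro Bochner_Integration.integrable_sum) (auto simp: emeasure_eq_measure)
    show "integrable M (\<lambda>x. real m * indicator B x)"
      using assms(4) by (auto simp: emeasure_eq_measure)
    fix x
    have "(\<Sum>k\<in>K. indicator (A k) x :: real) = real (card {k \<in> K. x \<in> A k})"
      using assms(1) by (simp add: indicator_def of_bool_def sum.If_cases Int_def)
    also have "\<dots> \<le> real m * indicator B x"
      using assms(3,5) by (cases "x \<in> B") (auto simp: indicator_def card_eq_0_iff)
    finally show "(\<Sum>k\<in>K. indicator (A k) x :: real) \<le> real m * indicator B x" .
  qed
  also have "\<dots> = real m * measure M B"
    using assms(4) sets.Int_space_eq2 by simp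
  finally show ?thesis .
qed

lemma inner_n_diff_le:
  assumes "\<And>i. i < n \<Longrightarrow> \<bar>x i - y i\<bar> \<le> d"
  shows "\<bar>inner_n n u x - inner_n n u y\<bar> \<le> d * (\<Sum>i<n. \<bar>u i\<bar>)"
proof -
  have "\<bar>inner_n n u x - inner_n n u y\<bar> = \<bar>\<Sum>i<n. u i * (x i - y i)\<bar>"
    by (simp add: inner_n_def sum_subtractf algebra_simps)
  also have "\<dots> \<le> (\<Sum>i<n. \<bar>u i * (x i - y i)\<bar>)"
    by (rule sum_abs)
  also have "\<dots> \<le> (\<Sum>i<n. \<bar>u i\<bar> * d)"
    using assms by (intro sum_mono) (auto simp: abs_mult intro!: mult_left_mono)
  finally show ?thesis
    by (simp add: sum_distrib_left mult.commute)
qed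

lemma inner_n_midpoint: "inner_n n u (\<lambda>i. (x i + y i) / 2) = (inner_n n u x + inner_n n u y) / 2"
  by (simp add: inner_n_def sum_divide_distrib distrib_left flip: sum.distrib add_divide_distrib)

section \<open>Cells under a log-concave measure\<close>

locale log_concave =
  fixes n :: nat and \<mu> :: "(nat \<Rightarrow> real) measure"
  assumes lc: "log_concave_prob n \<mu>"
begin

sublocale prob_space \<mu>
  using lc by (simp add: log_concave_prob_def)

lemma sets_mu: "sets \<mu> = sets (borel_Rn n)"
  using lc by (simp add: log_concave_prob_def)

lemma space_mu: "space \<mu> = Rn n"
  using sets_eq_imp_space_eq[OF sets_mu] by (simp add: borel_Rn_def space_restrict_space)

lemma cell_subset_space: "cell n r m \<subseteq> space \<mu>"
  by (auto simp: cell_def space_mu)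

lemma cell_sets [measurable]: "cell n r m \<in> sets \<mu>"
proof -
  have "cell n r m = Rn n \<inter> cell n r m"
    by (auto simp: cell_def)
  moreover have "cell n r m \<in> sets borel"
    by (intro borel_closed compact_imp_closed compact_cell)
  ultimately show ?thesis
    unfolding sets_mu borel_Rn_def sets_restrict_space by (rule image_eqI)
qed

lemma halfspace_sets [measurable]: "{x \<in> Rn n. inner_n n u x \<le> a} \<in> sets \<mu>"
proof -
  have "{x \<in> Rn n. inner_n n u x \<le> a} = Rn n \<inter> {x. inner_n n u x \<le> a}"
    by auto
  moreover have "closed {x. inner_n n u x \<le> a}"
    unfolding inner_n_def
    by (intro closed_Collect_le continuous_intros continuous_on_product_coordinates)
  ultimately show ?thesis
    unfolding sets_mu borel_Rn_def sets_restrict_space by (intro image_eqI[OF _ borel_closed])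
qed

text \<open>The discrete form of midpoint log-concavity. Both cells have half-width
  \<open>r\<close>, so averaging a point near \<open>r * v\<close> with a point near
  \<open>r * w\<close> lands in the cell of the same half-width at the midpoint.\<close>

lemma measure_cell_midpoint:
  "sqrt (measure \<mu> (cell n r (\<lambda>i. 2 * v i))) * sqrt (measure \<mu> (cell n r (\<lambda>i. 2 * w i)))
     \<le> measure \<mu> (cell n r (\<lambda>i. v i + w i))"
proof -
  let ?A = "cell n r (\<lambda>i. 2 * v i)" and ?B = "cell n r (\<lambda>i. 2 * w i)"
  have "measure \<mu> ?A powr (1/2) * measure \<mu> ?B powr (1 - 1/2) \<le> measure \<mu> (minkowski_comb (1/2) ?A ?B)"
  proof -
    have "?A \<subseteq> Rn n" "?B \<subseteq> Rn n"
      by (auto simp: cell_def)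
    then show ?thesis
      using lc compact_cell[of n r] unfolding log_concave_prob_def
      by (elim conjE allE[of _ ?A] allE[of _ ?B] allE[of _ "1/2::real"]) simp
  qed
  also have "\<dots> \<le> measure \<mu> (cell n r (\<lambda>i. v i + w i))"
  proof (rule finite_measure_mono[OF _ cell_sets])
    show "minkowski_comb (1/2) ?A ?B \<subseteq> cell n r (\<lambda>i. v i + w i)"
    proof
      fix x assume "x \<in> minkowski_comb (1/2) ?A ?B"
      then obtain a b where ab: "a \<in> ?A" "b \<in> ?B" and x: "x = (\<lambda>i. 1/2 * a i + (1 - 1/2) * b i)"
        unfolding minkowski_comb_def by blast
      have "\<bar>x i - r * of_int (v i + w i) / 2\<bar> \<le> r" if "i < n" for i
      proof -
        have "\<bar>a i - r * of_int (v i)\<bar> \<le> r" "\<bar>b i - r * of_int (w i)\<bar> \<le> r"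
          using ab that by (auto simp: cell_def)
        moreover have "x i - r * of_int (v i + w i) / 2
            = ((a i - r * of_int (v i)) + (b i - r * of_int (w i))) / 2"
          by (simp add: x field_simps)
        moreover have "\<bar>(p + q) / 2\<bar> \<le> r" if "\<bar>p\<bar> \<le> r" "\<bar>q\<bar> \<le> r" for p q :: real
          using that unfolding abs_le_iff by (auto simp: field_simps)
        ultimately show ?thesis
          by metis
      qed
      then show "x \<in> cell n r (\<lambda>i. v i + w i)"
        using ab unfolding x by (auto simp: cell_def Rn_def)
    qed
  qed
  finally show ?thesis
    by (simp add: powr_half_sqrt)
qed

text \<open>Restricting to finitely many cells makes maxima and finite sums available. Growing boxes
  of cells exhaust the space, so any mass below 1 is reached; \<open>3/4\<close> leaves
  \<open>1/2\<close> after \<open>1/4\<close> is lost to light cells.\<close>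

lemma mass_in_lattice_box:
  assumes r: "r > 0"
  obtains K where "finite K" "K \<subseteq> Zn n" 
    "3/4 \<le> (\<Sum>k\<in>K. measure \<mu> (cell n r (\<lambda>i. 2 * k i)))"
proof -
  define K :: "nat \<Rightarrow> (nat \<Rightarrow> int) set" where "K T = PiE_dflt {..<n} 0 (\<lambda>_. {- int T..int T})" for T
  have fin: "finite (K T)" for T
    unfolding K_def by (intro finite_PiE_dflt) auto
  have K0: "K T \<subseteq> Zn n" for T
    by (simp add: K_def PiE_dflt_def Zn_def subset_iff)
  define U where "U T = (\<Union>k\<in>K T. cell n r (\<lambda>i. 2 * k i))" for T
  have "incseq U"
  proof (intro incseq_SucI)
    fix T
    have "K T \<subseteq> K (Suc T)"
      by (simp add: K_def PiE_dflt_def subset_iff) force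
    then show "U T \<subseteq> U (Suc T)"
      by (auto simp: U_def)
  qed
  have Us: "U T \<in> sets \<mu>" for T
    unfolding U_def using fin by (intro sets.finite_UN) auto
  have "(\<Union>T. U T) = space \<mu>"
  proof
    show "(\<Union>T. U T) \<subseteq> space \<mu>"
      by (auto simp: U_def cell_def space_mu)
    show "space \<mu> \<subseteq> (\<Union>T. U T)"
    proof
      fix x assume x: "x \<in> space \<mu>"
      \<comment> \<open>Rounding down to the lattice moves each coordinate of \<open>x\<close> by
        less than \<open>r\<close>; the sum in \<open>T\<close> dominates every coordinate of
        \<open>k\<close>.\<close>
      define k where "k i = \<lfloor>x i / r\<rfloor>" for i
      define T where "T = nat (\<Sum>i<n. \<bar>k i\<bar>)"
      have "\<bar>k i\<bar> \<le> int T" if "i < n" for i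
        unfolding T_def using that member_le_sum[of i "{..<n}" "\<lambda>i. \<bar>k i\<bar>"]
        by (simp add: sum_nonneg)
      then have "k i \<in> {- int T..int T}" if "i < n" for i
        using that by (simp add: abs_le_iff minus_le_iff)
      moreover have "k i = 0" if "i \<ge> n" for i
        using x that by (simp add: space_mu Rn_def k_def)
      ultimately have "k \<in> K T"
        by (simp add: K_def PiE_dflt_def)
      moreover have "x \<in> cell n r (\<lambda>i. 2 * k i)"
      proof -
        have "\<bar>x i - r * k i\<bar> \<le> r" for i
        proof -
          have "k i \<le> x i / r" "x i / r < k i + 1"
            unfolding k_def by linarith+
          then have "r * k i \<le> x i" "x i < r * k i + r"
            using r by (simp_all add: field_simps)
          then show ?thesis by linarith
        qed
        then show ?thesis
          using x by (auto simp: cell_def space_mu)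
      qed
      ultimately show "x \<in> (\<Union>T. U T)"
        by (auto simp: U_def)
    qed
  qed
  moreover have "(\<lambda>T. measure \<mu> (U T)) \<longlonglongrightarrow> measure \<mu> (\<Union>T. U T)"
    using Us \<open>incseq U\<close> by (intro finite_Lim_measure_incseq) auto
  ultimately have "(\<lambda>T. measure \<mu> (U T)) \<longlonglongrightarrow> 1"
    by (simp add: prob_space)
  then have "\<forall>\<^sub>F T in sequentially. 3/4 < measure \<mu> (U T)"
    by (rule order_tendstoD) simp
  then obtain T where T: "3/4 < measure \<mu> (U T)"
    using eventually_happens'[OF sequentially_bot] by metis
  have "measure \<mu> (U T) \<le> (\<Sum>k\<in>K T. measure \<mu> (cell n r (\<lambda>i. 2 * k i)))"
    unfolding U_def using fin by (intro finite_measure_subadditive_finite) auto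
  with T fin K0 show ?thesis
    by (intro that[of "K T"]) auto
qed

text \<open>Successive centres are \<open>r / 2\<close> apart and the half-width is
  \<open>r\<close>, that is 2 lattice units.\<close>

lemma cell_overlap:
  assumes "r > 0" "K \<subseteq> Zn n" "finite K"
  shows "card {k \<in> K. x \<in> cell n r (\<lambda>i. k i + w i)} \<le> 5 ^ n"
proof -
  have "{k \<in> K. x \<in> cell n r (\<lambda>i. k i + w i)} \<subseteq> {k \<in> K. \<forall>i<n. \<bar>of_int (k i) - (2 * x i / r - w i)\<bar> \<le> 2}"
  proof (clarsimp simp: cell_def)
    fix k i assume "\<forall>i<n. \<bar>x i - r * (of_int (k i) + of_int (w i)) / 2\<bar> \<le> r" "i < n"
    then have "\<bar>x i - r * (of_int (k i) + of_int (w i)) / 2\<bar> \<le> r" by blast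
    then show "\<bar>of_int (k i) - (2 * x i / r - of_int (w i))\<bar> \<le> 2"
      using assms(1) by (simp add: abs_le_iff field_simps)
  qed
  moreover have "finite {k \<in> K. \<forall>i<n. \<bar>of_int (k i) - (2 * x i / r - w i)\<bar> \<le> 2}"
    using assms(3) by simp
  ultimately show ?thesis
    using card_lattice_le[OF assms(2), of "\<lambda>i. 2 * x i / r - w i"] by (meson card_mono order_trans)
qed

section \<open>Cells of mass comparable to the maximum\<close>

text \<open>\<open>M\<close> is the largest mass among finitely many cells, attained at
  \<open>k0\<close>. If a cell is light, the cell midway to \<open>k0\<close> has at least
  \<open>4 * 5 ^ n\<close> times its mass. These midway cells overlap at most \<open>5 ^ n\<close>
  times, so the light cells together carry at most \<open>1/4\<close>.\<close>

lemma heavy_cells: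
  assumes r: "r > 0"
  obtains R M where "finite R" "R \<subseteq> Zn n" "0 \<le> M" "1/2 \<le> M * real (card R)"
    "\<And>k. k \<in> R \<Longrightarrow> M / (16 * 25 ^ n) \<le> measure \<mu> (cell n r (\<lambda>i. 2 * k i))"
proof -
  obtain K where K: "finite K" "K \<subseteq> Zn n"
    and mass: "3/4 \<le> (\<Sum>k\<in>K. measure \<mu> (cell n r (\<lambda>i. 2 * k i)))"
    using mass_in_lattice_box[OF r] .
  define f where "f k = measure \<mu> (cell n r (\<lambda>i. 2 * k i))" for k
  define M where "M = Max (f ` K)"
  have "K \<noteq> {}"
    using mass by auto
  then have "M \<in> f ` K"
    unfolding M_def using K by (intro Max_in) auto
  then obtain k0 where k0: "k0 \<in> K" "M = f k0"
    by auto
  have fM: "f k \<le> M" if "k \<in> K" for k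
    unfolding M_def using K that by (intro Max_ge) auto
  have M0: "0 \<le> M"
    by (simp add: k0 f_def)
  \<comment> \<open>The square root of the factor \<open>1 / (16 * 25 ^ n)\<close> is
    \<open>1 / (4 * 5 ^ n)\<close>: its \<open>5 ^ n\<close> cancels the overlap and its 4 leaves
    the bound \<open>1/4\<close>.\<close>
  define R where "R = {k \<in> K. M / (16 * 25 ^ n) \<le> f k}"
  have R: "R \<subseteq> K" "finite R"
    using K by (auto simp: R_def)
  have light: "f k \<le> 1 / (4 * 5 ^ n) * measure \<mu> (cell n r (\<lambda>i. k i + k0 i))" if "k \<in> K - R" for k
  proof -
    have "f k = sqrt (f k) * sqrt (f k)"
      by (simp add: f_def)
    also have "\<dots> \<le> sqrt (f k) * sqrt (M / (16 * 25 ^ n))"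
      using that by (intro mult_left_mono real_sqrt_le_mono) (auto simp: R_def f_def)
    also have "sqrt (M / (16 * 25 ^ n)) = sqrt M / (4 * 5 ^ n)"
    proof -
      have "sqrt (16 * 25 ^ n) = (4 * 5 ^ n :: real)"
        by (rule real_sqrt_unique) (simp_all add: power2_eq_square flip: power_mult_distrib)
      then show ?thesis
        by (simp add: real_sqrt_divide)
    qed
    also have "sqrt (f k) * (sqrt M / (4 * 5 ^ n)) = 1 / (4 * 5 ^ n) * (sqrt (f k) * sqrt (f k0))"
      by (simp add: k0)
    also have "\<dots> \<le> 1 / (4 * 5 ^ n) * measure \<mu> (cell n r (\<lambda>i. k i + k0 i))"
      unfolding f_def by (intro mult_left_mono measure_cell_midpoint) simp
    finally show ?thesis .
  qed
  have "(\<Sum>k\<in>K-R. f k) \<le> 1 / (4 * 5 ^ n) * (\<Sum>k\<in>K-R. measure \<mu> (cell n r (\<lambda>i. k i + k0 i)))"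
    unfolding sum_distrib_left using light by (rule sum_mono)
  also have "(\<Sum>k\<in>K-R. measure \<mu> (cell n r (\<lambda>i. k i + k0 i))) \<le> real (5 ^ n) * measure \<mu> (space \<mu>)"
  proof (rule sum_measure_le_overlap)
    show "card {k \<in> K - R. x \<in> cell n r (\<lambda>i. k i + k0 i)} \<le> 5 ^ n" for x
      using K by (intro cell_overlap r) auto
  qed (use K(1) in \<open>simp_all add: cell_subset_space cell_sets\<close>)
  finally have "(\<Sum>k\<in>K-R. f k) \<le> 1 / (4 * 5 ^ n) * (real (5 ^ n) * measure \<mu> (space \<mu>))"
    by - (erule meta_mp, intro mult_left_mono, simp_all)
  then have "(\<Sum>k\<in>K-R. f k) \<le> 1/4"
    by (simp add: prob_space)
  moreover have "(\<Sum>k\<in>K. f k) = (\<Sum>k\<in>K-R. f k) + (\<Sum>k\<in>R. f k)"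
    using K R by (intro sum.subset_diff)
  ultimately have "1/2 \<le> (\<Sum>k\<in>R. f k)"
    using mass by (simp add: f_def)
  also have "\<dots> \<le> M * real (card R)"
    using sum_bounded_above[of R f M] fM R by (auto simp: mult.commute)
  finally show ?thesis
    using R K M0 by (intro that[of R M]) (auto simp: R_def f_def)
qed

section \<open>Half-spaces and pairs of cells\<close>

text \<open>If \<open>x\<close> lies near the midpoint of \<open>r v\<close> and \<open>r w\<close>, then every half-space containing \<open>x\<close>
  nearly contains \<open>r v\<close> or \<open>r w\<close>; so many such pairs force a large half-space mass.\<close>

lemma halfspace_ge_pairs:
  fixes u :: "nat \<Rightarrow> real"
  assumes r: "r > 0" and R: "finite R" "R \<subseteq> Zn n"
    and b: "0 \<le> b" "\<And>k. k \<in> R \<Longrightarrow> b \<le> measure \<mu> (cell n r (\<lambda>i. 2 * k i))"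
    and x: "inner_n n u x \<le> a"
  shows "b * real (card {p \<in> R \<times> R. x \<in> cell n r (\<lambda>i. fst p i + snd p i)})
    \<le> 2 * 25 ^ n * measure \<mu> {y \<in> Rn n. inner_n n u y \<le> a + 2 * r * (\<Sum>i<n. \<bar>u i\<bar>)}"
    (is "b * real (card ?S) \<le> 2 * 25 ^ n * measure \<mu> ?H")
proof -
  define U where "U = (\<Sum>i<n. \<bar>u i\<bar>)"
  \<comment> \<open>Passing from \<open>x\<close> to the midpoint of a pair costs
    \<open>r * U\<close>, and one of two numbers is at most their mean; so every pair in
    \<open>?S\<close> has a member in \<open>P\<close>.\<close>
  define P where "P = {k \<in> R. inner_n n u (\<lambda>i. r * of_int (k i)) \<le> a + r * U}"
  have P: "finite P" "P \<subseteq> R"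
    using R by (auto simp: P_def)
  let ?W = "\<lambda>v. {w \<in> R. x \<in> cell n r (\<lambda>i. w i + v i)}"
  have W: "card (?W v) \<le> 5 ^ n" for v
    using R by (intro cell_overlap r)
  \<comment> \<open>The member in \<open>P\<close> comes first, after a swap if necessary; once it
    is fixed, at most \<open>5 ^ n\<close> partners remain.\<close>
  have "?S \<subseteq> Sigma P ?W \<union> prod.swap ` Sigma P ?W"
  proof
    fix p assume p: "p \<in> ?S"
    obtain v w where vw: "p = (v, w)" by fastforce
    have vwR: "v \<in> R" "w \<in> R" and xc: "x \<in> cell n r (\<lambda>i. v i + w i)"
      using p vw by auto
    have "\<bar>inner_n n u x - inner_n n u (\<lambda>i. (r * of_int (v i) + r * of_int (w i)) / 2)\<bar> \<le> r * U"
      unfolding U_def using xc by (intro inner_n_diff_le) (auto simp: cell_def algebra_simps)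
    then have "(inner_n n u (\<lambda>i. r * of_int (v i)) + inner_n n u (\<lambda>i. r * of_int (w i))) / 2 \<le> a + r * U"
      using x unfolding inner_n_midpoint abs_le_iff by linarith
    then have "inner_n n u (\<lambda>i. r * of_int (v i)) \<le> a + r * U \<or> inner_n n u (\<lambda>i. r * of_int (w i)) \<le> a + r * U"
      by argo
    then have "v \<in> P \<or> w \<in> P"
      using vwR by (auto simp: P_def)
    moreover have "w \<in> ?W v" "v \<in> ?W w"
      using vwR xc by (auto simp: add.commute)
    ultimately have "(v, w) \<in> Sigma P ?W \<or> (w, v) \<in> Sigma P ?W"
      by blast
    then show "p \<in> Sigma P ?W \<union> prod.swap ` Sigma P ?W"
    proof
      assume "(w, v) \<in> Sigma P ?W"
      then have "prod.swap (w, v) \<in> prod.swap ` Sigma P ?W"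
        by (rule imageI)
      then show ?thesis
        unfolding vw swap_simp by (rule UnI2)
    qed (unfold vw, rule UnI1)
  qed
  moreover have fin: "finite (Sigma P ?W)"
    using P R by auto
  ultimately have "card ?S \<le> card (Sigma P ?W \<union> prod.swap ` Sigma P ?W)"
    by (intro card_mono) auto
  also have "\<dots> \<le> card (Sigma P ?W) + card (prod.swap ` Sigma P ?W)"
    by (rule card_Un_le)
  also have "\<dots> \<le> 2 * card (Sigma P ?W)"
    using card_image_le[OF fin, of prod.swap] by simp
  also have "card (Sigma P ?W) \<le> card P * 5 ^ n"
    using sum_bounded_above[of P "\<lambda>v. card (?W v)" "5 ^ n"] W P R by simp
  finally have S: "card ?S \<le> 2 * (card P * 5 ^ n)" by simp
  \<comment> \<open>Passing from the centre of a cell to its points costs a second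
    \<open>r * U\<close>, whence the \<open>2 * r\<close> in \<open>?H\<close>.\<close>
  have "b * real (card P) \<le> (\<Sum>k\<in>P. measure \<mu> (cell n r (\<lambda>i. k i + k i)))"
    using sum_bounded_below[of P b "\<lambda>k. measure \<mu> (cell n r (\<lambda>i. 2 * k i))"] b P
    by (auto simp: mult.commute mult_2)
  also have "\<dots> \<le> real (5 ^ n) * measure \<mu> ?H"
  proof (rule sum_measure_le_overlap)
    fix k assume k: "k \<in> P"
    show "cell n r (\<lambda>i. k i + k i) \<subseteq> ?H"
    proof
      fix y assume y: "y \<in> cell n r (\<lambda>i. k i + k i)"
      have "\<bar>inner_n n u y - inner_n n u (\<lambda>i. r * of_int (k i))\<bar> \<le> r * U"
        unfolding U_def using y by (intro inner_n_diff_le) (auto simp: cell_def)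
      moreover have "inner_n n u (\<lambda>i. r * of_int (k i)) \<le> a + r * U"
        using k by (simp add: P_def)
      ultimately have "inner_n n u y \<le> a + 2 * r * U"
        by linarith
      then show "y \<in> ?H"
        using y by (simp add: cell_def U_def)
    qed
  next
    fix y
    \<comment> \<open>The centres \<open>r * k\<close> are \<open>r\<close> apart, so the distance
      in lattice units is at most 1; it is relaxed to 2 to fit
      \<open>card_lattice_le\<close>.\<close>
    have "card {k \<in> P. y \<in> cell n r (\<lambda>i. k i + k i)}
      \<le> card {k \<in> P. \<forall>i<n. \<bar>of_int (k i) - y i / r\<bar> \<le> 2}"
    proof (intro card_mono Collect_mono impI conjI allI)
      fix k i assume *: "k \<in> P \<and> y \<in> cell n r (\<lambda>i. k i + k i)" "i < n"
      then have "\<bar>y i - r * of_int (k i)\<bar> \<le> r"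
        by (auto simp: cell_def)
      then have "\<bar>of_int (k i) - y i / r\<bar> \<le> 1"
        using r by (simp add: abs_le_iff field_simps)
      then show "\<bar>of_int (k i) - y i / r\<bar> \<le> 2"
        by linarith
    qed (use P in auto)
    also have "\<dots> \<le> 5 ^ n"
      using P R by (intro card_lattice_le) auto
    finally show "card {k \<in> P. y \<in> cell n r (\<lambda>i. k i + k i)} \<le> 5 ^ n" .
  qed (use P in auto)
  finally have bP: "b * real (card P) \<le> 5 ^ n * measure \<mu> ?H" by simp
  have "b * real (card ?S) \<le> b * real (2 * (card P * 5 ^ n))"
    using S b by (intro mult_left_mono of_nat_mono) auto
  also have "\<dots> = 2 * 5 ^ n * (b * real (card P))"
    by simp
  also have "\<dots> \<le> 2 * 5 ^ n * (5 ^ n * measure \<mu> ?H)"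
    using bP by (intro mult_left_mono) auto
  also have "\<dots> = 2 * 25 ^ n * measure \<mu> ?H"
    by (simp flip: power_mult_distrib mult.assoc)
  finally show ?thesis .
qed

section \<open>A measurable minorant of the depth, up to enlargement\<close>

text \<open>\<open>G\<close> is a multiple of the number of pairs of heavy cells whose midpoint cell
  contains \<open>x\<close>, scaled so that \<open>halfspace_ge_pairs\<close> applies. Each such
  midpoint cell again has mass at least the threshold \<open>b\<close>, so the integral of
  \<open>G\<close> is at least a multiple of \<open>(b * card R)^2\<close>, and
  \<open>M * card R \<ge> 1/2\<close> makes this exponential in \<open>n\<close> alone.\<close>

lemma depth_minorant:
  assumes r: "r > 0"
  obtains G :: "(nat \<Rightarrow> real) \<Rightarrow> real" where "G \<in> borel_measurable \<mu>"
    "ennreal (1 / (2048 * 15625 ^ n)) \<le> (\<integral>\<^sup>+x. ennreal (G x) \<partial>\<mu>)"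
    "\<And>x u a. inner_n n u x \<le> a \<Longrightarrow>
       G x \<le> measure \<mu> {y \<in> Rn n. inner_n n u y \<le> a + 2 * r * (\<Sum>i<n. \<bar>u i\<bar>)}"
proof -
  obtain R M where R: "finite R" "R \<subseteq> Zn n" and M0: "0 \<le> M"
    and MR: "1/2 \<le> M * real (card R)"
    and Rf: "\<And>k. k \<in> R \<Longrightarrow> M / (16 * 25 ^ n) \<le> measure \<mu> (cell n r (\<lambda>i. 2 * k i))"
    by (rule heavy_cells[OF r]) (rule that)
  define b where "b = M / (16 * 25 ^ n)"
  have b0: "0 \<le> b"
    using M0 by (simp add: b_def)
  let ?C = "\<lambda>p. cell n r (\<lambda>i. fst p i + snd p i)"
  define G where "G x = b / (2 * 25 ^ n) * (\<Sum>p\<in>R \<times> R. indicator (?C p) x)" for x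
  have G_card: "G x = b / (2 * 25 ^ n) * real (card {p \<in> R \<times> R. x \<in> ?C p})" for x
    using R by (simp add: G_def indicator_def of_bool_def sum.If_cases Int_def)
  have pair: "b \<le> measure \<mu> (?C p)" if "p \<in> R \<times> R" for p
  proof -
    have "b = sqrt b * sqrt b"
      using b0 by simp
    also have "\<dots> \<le> sqrt (measure \<mu> (cell n r (\<lambda>i. 2 * fst p i))) * sqrt (measure \<mu> (cell n r (\<lambda>i. 2 * snd p i)))"
      using that Rf b0 by (intro mult_mono real_sqrt_le_mono) (auto simp: b_def)
    also have "\<dots> \<le> measure \<mu> (?C p)"
      by (rule measure_cell_midpoint)
    finally show ?thesis .
  qed
  show ?thesis
  proof (rule that[of G])
    show "G \<in> borel_measurable \<mu>"
      unfolding G_def by measurable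
    fix u x a assume "inner_n n u x \<le> a"
    then show "G x \<le> measure \<mu> {y \<in> Rn n. inner_n n u y \<le> a + 2 * r * (\<Sum>i<n. \<bar>u i\<bar>)}"
      using halfspace_ge_pairs[OF r R b0, of u x a] Rf by (simp add: G_card b_def field_simps)
  next
    have int: "integrable \<mu> (\<lambda>x. indicator (?C p) x :: real)" for p
      by (simp add: emeasure_eq_measure)
    \<comment> \<open>\<open>512 * 15625 ^ n\<close> is \<open>2 * 25 ^ n\<close> times the square
      of \<open>16 * 25 ^ n\<close>, the denominator of \<open>b\<close>.\<close>
    have "1 / (2048 * 15625 ^ n) = (1/2)\<^sup>2 / (512 * 15625 ^ n :: real)"
      by (simp add: power2_eq_square)
    also have "\<dots> \<le> (M * real (card R))\<^sup>2 / (512 * 15625 ^ n)"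
      using MR by (intro divide_right_mono power_mono) auto
    also have "\<dots> = b / (2 * 25 ^ n) * (real (card (R \<times> R)) * b)"
    proof -
      have "(15625::real) ^ n = 25 ^ n * 25 ^ n * 25 ^ n"
        by (simp flip: power_mult_distrib)
      then show ?thesis
        by (simp add: b_def power2_eq_square card_cartesian_product mult_ac)
    qed
    also have "\<dots> \<le> b / (2 * 25 ^ n) * (\<Sum>p\<in>R \<times> R. measure \<mu> (?C p))"
      using b0 by (intro mult_left_mono sum_bounded_below pair) auto
    also have "(\<Sum>p\<in>R \<times> R. measure \<mu> (?C p)) = (\<integral>x. (\<Sum>p\<in>R \<times> R. indicator (?C p) x) \<partial>\<mu>)"
      using int by (subst Bochner_Integration.integral_sum) (auto simp: sets.Int_space_eq2)
    also have "b / (2 * 25 ^ n) * \<dots> = (\<integral>x. G x \<partial>\<mu>)"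
      unfolding G_def by simp
    finally have "ennreal (1 / (2048 * 15625 ^ n)) \<le> ennreal (\<integral>x. G x \<partial>\<mu>)"
      by (rule ennreal_leI)
    also have "\<dots> = (\<integral>\<^sup>+x. ennreal (G x) \<partial>\<mu>)"
    proof (rule nn_integral_eq_integral[symmetric])
      show "integrable \<mu> G"
        unfolding G_def using int by (intro integrable_mult_right Bochner_Integration.integrable_sum)
      show "AE x in \<mu>. 0 \<le> G x"
        using b0 by (simp add: G_card)
    qed
    finally show "ennreal (1 / (2048 * 15625 ^ n)) \<le> (\<integral>\<^sup>+x. ennreal (G x) \<partial>\<mu>)" .
  qed
qed

section \<open>Letting the cells shrink\<close>

text \<open>Continuity from above: the half-spaces are closed, so the enlarged ones decrease exactly
  to the original one.\<close>

lemma measure_halfspace_tendsto: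
  "(\<lambda>j. measure \<mu> {y \<in> Rn n. inner_n n u y \<le> a + 2 * (1 / real (Suc j)) * U})
     \<longlonglongrightarrow> measure \<mu> {y \<in> Rn n. inner_n n u y \<le> a}" if "0 \<le> U"
proof -
  let ?H = "\<lambda>j. {y \<in> Rn n. inner_n n u y \<le> a + 2 * (1 / real (Suc j)) * U}"
  have lim: "(\<lambda>j. a + 2 * (1 / real (Suc j)) * U) \<longlonglongrightarrow> a + 2 * 0 * U"
    unfolding inverse_eq_divide[symmetric] by (intro tendsto_intros LIMSEQ_inverse_real_of_nat)
  have "(\<Inter>j. ?H j) = {y \<in> Rn n. inner_n n u y \<le> a}"
  proof (intro equalityI subsetI)
    fix y assume y: "y \<in> (\<Inter>j. ?H j)"
    then have "inner_n n u y \<le> a + 2 * 0 * U"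
      by (intro LIMSEQ_le_const[OF lim]) auto
    with y show "y \<in> {y \<in> Rn n. inner_n n u y \<le> a}" by auto
  next
    fix y assume "y \<in> {y \<in> Rn n. inner_n n u y \<le> a}"
    moreover have "0 \<le> 2 * (1 / real (Suc j)) * U" for j
      using that by simp
    ultimately show "y \<in> (\<Inter>j. ?H j)"
      by (auto intro: order_trans[OF _ le_add_same_cancel1[THEN iffD2]])
  qed
  moreover have "decseq ?H"
  proof (rule decseq_SucI)
    fix j
    have "2 * (1 / real (Suc (Suc j))) * U \<le> 2 * (1 / real (Suc j)) * U"
      using that by (intro mult_right_mono mult_left_mono divide_left_mono) auto
    then show "?H (Suc j) \<subseteq> ?H j"
      by auto
  qed
  moreover have "(\<lambda>j. measure \<mu> (?H j)) \<longlonglongrightarrow> measure \<mu> (\<Inter>j. ?H j)"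
    using \<open>decseq ?H\<close> by (intro finite_Lim_measure_decseq) (auto simp del: of_nat_Suc)
  ultimately show ?thesis by simp
qed

text \<open>Reverse Fatou along \<open>r = 1 / (j + 1)\<close>, dominated by 1. For a fixed
  half-space containing \<open>x\<close> the enlargement tends to 0, so its mass bounds the limsup
  of the minorants at \<open>x\<close>; then take the infimum over half-spaces.\<close>

lemma tukey_depth_integral_ge:
  assumes n: "n \<ge> 1"
  shows "ennreal (1 / (2048 * 15625 ^ n)) \<le> (\<integral>\<^sup>+x. ennreal (tukey_depth n \<mu> x) \<partial>\<mu>)"
proof -
  define good where "good j G \<longleftrightarrow> G \<in> borel_measurable \<mu> \<and>
      ennreal (1 / (2048 * 15625 ^ n)) \<le> (\<integral>\<^sup>+x. ennreal (G x) \<partial>\<mu>) \<and>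
      (\<forall>x u a. inner_n n u x \<le> a \<longrightarrow>
         G x \<le> measure \<mu> {y \<in> Rn n. inner_n n u y \<le> a + 2 * (1 / real (Suc j)) * (\<Sum>i<n. \<bar>u i\<bar>)})"
    for j :: nat and G :: "(nat \<Rightarrow> real) \<Rightarrow> real"
  have "\<exists>G. good j G" for j
  proof -
    have "0 < 1 / real (Suc j)" by simp
    then show ?thesis
      by (rule depth_minorant) (intro exI, unfold good_def, intro conjI allI impI)
  qed
  then obtain G where good: "\<And>j. good j (G j)"
    by metis
  have G [measurable]: "\<And>j. G j \<in> borel_measurable \<mu>"
    and G_int: "\<And>j. ennreal (1 / (2048 * 15625 ^ n)) \<le> (\<integral>\<^sup>+x. ennreal (G j x) \<partial>\<mu>)"
    and G_le: "\<And>j x u a. inner_n n u x \<le> a \<Longrightarrow>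
       G j x \<le> measure \<mu> {y \<in> Rn n. inner_n n u y \<le> a + 2 * (1 / real (Suc j)) * (\<Sum>i<n. \<bar>u i\<bar>)}"
    using good by (simp_all only: good_def)
  have G1: "ennreal (G j x) \<le> 1" for j x
    using order_trans[OF G_le[OF order_refl] prob_le_1] by (simp add: ennreal_le_1)
  have "ennreal (1 / (2048 * 15625 ^ n)) \<le> limsup (\<lambda>j. \<integral>\<^sup>+x. ennreal (G j x) \<partial>\<mu>)"
    by (intro le_Limsup) (auto simp: G_int)
  also have "\<dots> \<le> (\<integral>\<^sup>+x. limsup (\<lambda>j. ennreal (G j x)) \<partial>\<mu>)"
    by (intro nn_integral_limsup[where w = "\<lambda>_. 1"] always_eventually allI G1)
      (simp_all add: emeasure_space_1)
  also have "\<dots> \<le> (\<integral>\<^sup>+x. ennreal (tukey_depth n \<mu> x) \<partial>\<mu>)"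
  proof (rule nn_integral_mono)
    fix x assume x: "x \<in> space \<mu>"
    \<comment> \<open>The limsup lives in \<open>ennreal\<close>, the depth is a real infimum;
      \<open>l \<le> 1\<close> makes the conversion lossless.\<close>
    define l where "l = limsup (\<lambda>j. ennreal (G j x))"
    have "l \<le> 1"
      unfolding l_def by (intro Limsup_bounded always_eventually allI G1)
    then have l_real: "ennreal (enn2real l) = l"
      by (intro ennreal_enn2real) (auto simp: less_top[symmetric] top_unique)
    have "enn2real l \<le> tukey_depth n \<mu> x"
      unfolding tukey_depth_def
    proof (rule cINF_greatest)
      \<comment> \<open>A real infimum is bounded below this way only over a nonempty family; the
        first coordinate vector supplies a half-space, using \<open>n \<ge> 1\<close>.\<close>
      define e :: "nat \<Rightarrow> real" where "e = (\<lambda>i. if i = 0 then 1 else 0)"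
      have "{y \<in> Rn n. inner_n n e y \<le> inner_n n e x} \<in> {H \<in> halfspaces_Rn n. x \<in> H}"
        using n x by (auto simp: halfspaces_Rn_def space_mu e_def Rn_def intro!: exI[of _ e])
      then show "{H \<in> halfspaces_Rn n. x \<in> H} \<noteq> {}" by blast
    next
      fix H assume "H \<in> {H \<in> halfspaces_Rn n. x \<in> H}"
      then obtain u a where H: "H = {y \<in> Rn n. inner_n n u y \<le> a}" and xa: "inner_n n u x \<le> a"
        unfolding halfspaces_Rn_def by blast
      have "l \<le> limsup (\<lambda>j. ennreal (measure \<mu> {y \<in> Rn n. inner_n n u y \<le> a + 2 * (1 / real (Suc j)) * (\<Sum>i<n. \<bar>u i\<bar>)}))"
        unfolding l_def by (intro Limsup_mono always_eventually allI ennreal_leI G_le xa)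
      also have "\<dots> = ennreal (measure \<mu> H)"
        unfolding H
        by (intro lim_imp_Limsup sequentially_bot tendsto_ennrealI measure_halfspace_tendsto sum_nonneg) auto
      finally show "enn2real l \<le> measure \<mu> H"
        by (intro enn2real_leI) auto
    qed
    then show "limsup (\<lambda>j. ennreal (G j x)) \<le> ennreal (tukey_depth n \<mu> x)"
      unfolding l_def[symmetric] by (subst l_real[symmetric]) (rule ennreal_leI)
  qed
  finally show ?thesis .
qed

end

theorem theorem1p3:
  shows "\<exists>c>0. \<forall>n::nat. \<forall>\<mu>. n \<ge> 1 \<longrightarrow> log_concave_prob n \<mu> \<longrightarrow>
           (\<integral>\<^sup>+ x. ennreal (tukey_depth n \<mu> x) \<partial>\<mu>) \<ge> ennreal (exp (- c * real n))"
proof (intro exI[of _ "ln 32000000"] conjI allI impI)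
  fix n :: nat and \<mu> :: "(nat \<Rightarrow> real) measure"
  assume n: "n \<ge> 1" and lc: "log_concave_prob n \<mu>"
  interpret log_concave n \<mu>
    using lc by unfold_locales
  \<comment> \<open>Since \<open>n \<ge> 1\<close>, the prefactor 2048 is absorbed into
    \<open>2048 ^ n\<close>, and \<open>2048 * 15625 = 32000000\<close>.\<close>
  have "(2048::real) * 15625 ^ n \<le> 2048 ^ n * 15625 ^ n"
    using n power_increasing[of 1 n "2048::real"] by (intro mult_right_mono) auto
  also have "\<dots> = 32000000 ^ n"
    by (simp flip: power_mult_distrib)
  also have "\<dots> = exp (ln 32000000 * real n)"
    by (simp add: exp_of_nat2_mult)
  finally have "exp (- ln 32000000 * real n) \<le> 1 / (2048 * 15625 ^ n)"
    by (simp add: exp_minus field_simps)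
  then show "ennreal (exp (- ln 32000000 * real n)) \<le> (\<integral>\<^sup>+ x. ennreal (tukey_depth n \<mu> x) \<partial>\<mu>)"
    by (intro order_trans[OF ennreal_leI tukey_depth_integral_ge] n)
qed simp

end
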